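(* For each $n\ge 1$ let $X_{1,n},\dots,X_{n,n}$ be independent Bernoulli random variables with $P(X_{i,n}=1)=b(i;n)$, let $V_n=X_{1,n}+\cdots+X_{n,n}$, $\lambda_n=\sum_{i=1}^n b(i;n)$ and $m_n=\max_{1\le i\le n} b(i;n)$. If $\lim_{n\to+\infty}\lambda_n=+\infty$ and $\lim_{n\to\infty}\sum_{i=1}^n b^2(i;n)=0$, then $m_n\to 0$, and for every function $\phi(n)$ such that $\phi(n)\,m_n\to 0$ as $n\to+\infty$, $$\sup_{\{k:\,k^2\le\phi(n)\}}\left|\frac{P(V_n=k)}{e^{-\lambda_n}\lambda_n^k/k!}-1\right|\longrightarrow 0\qquad (n\to+\infty).$$
   Context: The $X_{i,n}$ take values in $\{0,1\}$ and are not assumed identically distributed; they form a triangular array, so $b(i;n)\in[0,1]$ may depend on $n$, and $b^2(i;n)$ means $(b(i;n))^2$. The function $\phi$ is a real-valued function of the positive integer $n$. In the supremum, $k$ ranges over non-negative integers (a supremum over the empty set is taken to be $0$). *)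

theory Defs
  imports "HOL-Probability.Probability"
begin

definition row_sum :: "(nat \<Rightarrow> nat \<Rightarrow> real) \<Rightarrow> nat \<Rightarrow> real" where
  "row_sum b n = (\<Sum>i=1..n. b i n)"

(* Unspecified for n = 0, which is never used: rows are indexed by n >= 1. *)
definition row_max :: "(nat \<Rightarrow> nat \<Rightarrow> real) \<Rightarrow> nat \<Rightarrow> real" where
  "row_max b n = Max ((\<lambda>i. b i n) ` {1..n})"

(* The library leaves the real supremum of the empty set unspecified; here it is 0. *)
definition sup_or_zero :: "nat set \<Rightarrow> (nat \<Rightarrow> real) \<Rightarrow> real" where
  "sup_or_zero S f = (if S = {} then 0 else (SUP k\<in>S. f k))"

(* X i n is the i-th variable of row n (i = 1..n); each row n >= 1 lives on its own
   probability space M n, and nothing is assumed across different rows. *)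
definition bernoulli_array ::
  "(nat \<Rightarrow> 'a measure) \<Rightarrow> (nat \<Rightarrow> nat \<Rightarrow> 'a \<Rightarrow> nat) \<Rightarrow> (nat \<Rightarrow> nat \<Rightarrow> real) \<Rightarrow> bool" where
  "bernoulli_array M X b \<longleftrightarrow>
    (\<forall>n\<ge>1. prob_space (M n) \<and>
      prob_space.indep_vars (M n) (\<lambda>_. count_space UNIV) (\<lambda>i. X i n) {1..n} \<and>
      (\<forall>i\<in>{1..n}. (\<forall>\<omega>\<in>space (M n). X i n \<omega> \<in> {0, 1}) \<and>
        measure (M n) {\<omega>\<in>space (M n). X i n \<omega> = 1} = b i n))"

end

theory Submission
  imports Defs
begin

text \<open>
  The idea is to compare the law of a sum of independent Bernoulli variables with the Poisson
  law of the same mean without taking any limit. The probability \<open>P(V = k)\<close> is the sum, over the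
  possible sets \<open>S\<close> of \<open>k\<close> successes, of \<open>(\<Prod>i\<in>S. b\<^sub>i) (\<Prod>i\<notin>S. 1 - b\<^sub>i)\<close>.
  Write \<open>\<lambda>\<close> for the sum of the \<open>b\<^sub>i\<close>, \<open>m\<close> for an upper bound of them and \<open>s\<close> for the sum of
  their squares. Two estimates separate the two products.

  \<^item> The failures contribute almost \<open>exp (- \<lambda>)\<close>, uniformly in \<open>S\<close>. From above, \<open>1 - x \<le> exp (- x)\<close>
    gives \<open>exp (k m - \<lambda>)\<close>, since the \<open>k\<close> indices of \<open>S\<close> remove at most \<open>k m\<close> from \<open>\<lambda>\<close>; from
    below, adding the missing factors and using \<open>ln (1 - x) \<ge> - x - 2 x\<^sup>2\<close> for \<open>x \<le> 1/2\<close> gives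
    \<open>exp (- \<lambda> - 2 s)\<close>.

  \<^item> The successes contribute the elementary symmetric polynomial \<open>e\<^sub>k\<close> of the \<open>b\<^sub>i\<close>. All the
    extensions of a \<open>k\<close>-set by one element together weigh between \<open>\<lambda> - k m\<close> and \<open>\<lambda>\<close> times as much
    as the set itself. Hence \<open>k! e\<^sub>k \<le> \<lambda>^k\<close> and, when \<open>k m \<le> \<lambda>\<close>, \<open>k! e\<^sub>k \<ge> (\<lambda> - k m)^k\<close>, which is
    at least \<open>\<lambda>^k (1 - k\<^sup>2 m / \<lambda>)\<close> by Bernoulli's inequality.

  Together, the ratio of \<open>P(V = k)\<close> to the Poisson weight is at most \<open>exp (k m)\<close>
  (\<open>poisson_ratio_upper\<close>) and, if the \<open>b\<^sub>i\<close> are at most \<open>1/2\<close> and \<open>k m \<le> \<lambda>\<close>, at least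
  \<open>exp (- 2 s) (1 - k\<^sup>2 m / \<lambda>)\<close> (\<open>poisson_ratio_lower\<close>). In row \<open>n\<close> take for \<open>m\<close> the maximum \<open>m\<^sub>n\<close>;
  it tends to \<open>0\<close> because \<open>m\<^sub>n\<^sup>2 \<le> s\<^sub>n\<close>. For \<open>k\<^sup>2 \<le> \<phi>(n)\<close> both \<open>k m\<^sub>n\<close> and \<open>k\<^sup>2 m\<^sub>n\<close> are at most
  \<open>\<phi>(n) m\<^sub>n\<close>, so once \<open>\<lambda>\<^sub>n \<ge> 1\<close> the two bounds can be
  replaced by expressions in \<open>\<phi>(n) m\<^sub>n\<close> and \<open>s\<^sub>n\<close> alone, which tend to \<open>1\<close>.
\<close>

section \<open>Elementary symmetric polynomials\<close>

definition elem_sym :: "'i set \<Rightarrow> ('i \<Rightarrow> 'b::comm_semiring_1) \<Rightarrow> nat \<Rightarrow> 'b" where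
  "elem_sym I b k = (\<Sum>S | S \<subseteq> I \<and> card S = k. \<Prod>i\<in>S. b i)"

lemma elem_sym_0:
  assumes "finite I"
  shows "elem_sym I b 0 = 1"
proof -
  have "{S. S \<subseteq> I \<and> card S = 0} = {{}}"
    using assms by (auto dest: finite_subset)
  then show ?thesis by (simp add: elem_sym_def)
qed

lemma elem_sym_nonneg:
  fixes b :: "'i \<Rightarrow> 'b::linordered_idom"
  assumes "\<And>i. i \<in> I \<Longrightarrow> 0 \<le> b i"
  shows "0 \<le> elem_sym I b k"
  unfolding elem_sym_def using assms by (intro sum_nonneg prod_nonneg) auto

text \<open>Double counting: both sides sum the weight of \<open>T\<close> over all pairs of a \<open>(k+1)\<close>-set \<open>T\<close> and
  an element \<open>i\<close> of \<open>T\<close>, on the right through \<open>S = T - {i}\<close>.\<close>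

lemma Suc_times_elem_sym_Suc:
  assumes "finite I"
  shows "of_nat (Suc k) * elem_sym I b (Suc k)
       = (\<Sum>S | S \<subseteq> I \<and> card S = k. (\<Prod>i\<in>S. b i) * (\<Sum>i\<in>I - S. b i))"
proof -
  have fin: "finite {S. S \<subseteq> I \<and> card S = j}" for j
    using assms by simp
  have finS: "finite S" if "S \<subseteq> I" for S
    using assms that by (rule finite_subset[rotated])
  have "of_nat (Suc k) * elem_sym I b (Suc k)
      = (\<Sum>T | T \<subseteq> I \<and> card T = Suc k. \<Sum>i\<in>T. \<Prod>j\<in>T. b j)"
    unfolding elem_sym_def sum_distrib_left by (intro sum.cong) auto
  also have "\<dots> = (\<Sum>(T, i)\<in>Sigma {T. T \<subseteq> I \<and> card T = Suc k} (\<lambda>T. T). \<Prod>j\<in>T. b j)"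
    using fin finS by (subst sum.Sigma) auto
  also have "\<dots> = (\<Sum>(S, i)\<in>Sigma {S. S \<subseteq> I \<and> card S = k} (\<lambda>S. I - S). (\<Prod>j\<in>S. b j) * b i)"
    by (rule sum.reindex_bij_witness[where
            j = "\<lambda>(T, i). (T - {i}, i)" and i = "\<lambda>(S, i). (insert i S, i)"])
       (auto simp: finS card_Diff_singleton prod.remove mult.commute)
  also have "\<dots> = (\<Sum>S | S \<subseteq> I \<and> card S = k. (\<Prod>i\<in>S. b i) * (\<Sum>i\<in>I - S. b i))"
    unfolding sum_distrib_left using fin assms by (subst sum.Sigma) auto
  finally show ?thesis .
qed

lemma fact_elem_sym_le:
  fixes b :: "'i \<Rightarrow> real"
  assumes "finite I" and nn: "\<And>i. i \<in> I \<Longrightarrow> 0 \<le> b i"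
  shows "fact k * elem_sym I b k \<le> sum b I ^ k"
proof (induction k)
  case 0
  then show ?case using elem_sym_0[OF assms(1), of b] by simp
next
  case (Suc k)
  have "of_nat (Suc k) * elem_sym I b (Suc k)
      \<le> (\<Sum>S | S \<subseteq> I \<and> card S = k. (\<Prod>i\<in>S. b i) * sum b I)"
    unfolding Suc_times_elem_sym_Suc[OF assms(1)] using assms
    by (intro sum_mono mult_left_mono sum_mono2 prod_nonneg) auto
  also have "\<dots> = elem_sym I b k * sum b I"
    by (simp add: elem_sym_def sum_distrib_right)
  finally have "fact k * (of_nat (Suc k) * elem_sym I b (Suc k))
      \<le> fact k * (elem_sym I b k * sum b I)"
    by (rule mult_left_mono) simp
  also have "\<dots> \<le> sum b I ^ k * sum b I"
    using mult_right_mono[OF Suc.IH, of "sum b I"] nn by (simp add: sum_nonneg mult.assoc)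
  finally show ?case by (simp add: algebra_simps)
qed

text \<open>The product \<open>\<lambda> (\<lambda> - m) \<dots> (\<lambda> - (k - 1) m)\<close> that the recursion yields is weakened to a pure
  power, which is what Bernoulli's inequality needs.\<close>

lemma fact_elem_sym_ge:
  fixes b :: "'i \<Rightarrow> real"
  assumes "finite I" and nn: "\<And>i. i \<in> I \<Longrightarrow> 0 \<le> b i" and le: "\<And>i. i \<in> I \<Longrightarrow> b i \<le> m"
    and "0 \<le> m" and "real k * m \<le> sum b I"
  shows "(sum b I - real k * m) ^ k \<le> fact k * elem_sym I b k"
  using \<open>real k * m \<le> sum b I\<close>
proof (induction k)
  case 0
  then show ?case using elem_sym_0[OF assms(1), of b] by simp
next
  case (Suc k)
  let ?c = "sum b I - real k * m"
  have c: "0 \<le> sum b I - real (Suc k) * m" "sum b I - real (Suc k) * m \<le> ?c" "0 \<le> ?c"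
    using Suc.prems \<open>0 \<le> m\<close> by (auto simp: algebra_simps)
  have rest: "?c \<le> (\<Sum>i\<in>I - S. b i)" if "S \<subseteq> I" "card S = k" for S
  proof -
    have "sum b S \<le> real k * m"
      using sum_bounded_above[of S b m] le that by auto
    then show ?thesis
      using that assms(1) by (simp add: sum_diff)
  qed
  have "(sum b I - real (Suc k) * m) ^ Suc k \<le> ?c ^ Suc k"
    using c by (intro power_mono) auto
  also have "\<dots> \<le> fact k * elem_sym I b k * ?c"
    using mult_right_mono[OF Suc.IH, of ?c] c by (simp add: mult.commute)
  also have "\<dots> = fact k * (\<Sum>S | S \<subseteq> I \<and> card S = k. (\<Prod>i\<in>S. b i) * ?c)"
    by (simp add: elem_sym_def sum_distrib_right mult.assoc)
  also have "\<dots> \<le> fact k * (of_nat (Suc k) * elem_sym I b (Suc k))"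
    unfolding Suc_times_elem_sym_Suc[OF assms(1)] using nn rest
    by (intro mult_left_mono sum_mono prod_nonneg) auto
  also have "\<dots> = fact (Suc k) * elem_sym I b (Suc k)"
    by (simp add: algebra_simps)
  finally show ?case .
qed

section \<open>The law of a sum of independent Bernoulli variables\<close>

definition poisson_binomial :: "'i set \<Rightarrow> ('i \<Rightarrow> real) \<Rightarrow> nat \<Rightarrow> real" where
  "poisson_binomial I b k =
     (\<Sum>S | S \<subseteq> I \<and> card S = k. (\<Prod>i\<in>S. b i) * (\<Prod>i\<in>I - S. 1 - b i))"

text \<open>The event that the sum equals \<open>k\<close> is split according to the set of indices at which
  the variables take the value \<open>1\<close>.\<close>

lemma (in prob_space) prob_sum_bernoulli:
  fixes X :: "'i \<Rightarrow> 'a \<Rightarrow> nat"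
  assumes "finite I" and "indep_vars (\<lambda>_. count_space UNIV) X I"
    and range: "\<And>i \<omega>. i \<in> I \<Longrightarrow> \<omega> \<in> space M \<Longrightarrow> X i \<omega> \<in> {0, 1}"
    and b: "\<And>i. i \<in> I \<Longrightarrow> prob {\<omega>\<in>space M. X i \<omega> = 1} = b i"
  shows "prob {\<omega>\<in>space M. (\<Sum>i\<in>I. X i \<omega>) = k} = poisson_binomial I b k"
proof -
  define v where "v S i = (if i \<in> S then 1 else 0 :: nat)" for S and i :: 'i
  define E where "E S = {\<omega>\<in>space M. \<forall>i\<in>I. X i \<omega> = v S i}" for S
  have meas: "X i \<in> measurable M (count_space UNIV)" if "i \<in> I" for i
    using assms(2) that by (auto simp: indep_vars_def)
  have event: "{\<omega>\<in>space M. X i \<omega> = c} \<in> events" if "i \<in> I" for i c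
    using measurable_sets[OF meas[OF that], of "{c}"] by (simp add: vimage_def Int_def conj_commute)
  have prob0: "prob {\<omega>\<in>space M. X i \<omega> = 0} = 1 - b i" if "i \<in> I" for i
  proof -
    have "{\<omega>\<in>space M. X i \<omega> = 0} = space M - {\<omega>\<in>space M. X i \<omega> = 1}"
      using range[OF that] by auto
    then show ?thesis
      using prob_compl[OF event[OF that, of 1]] b[OF that] by simp
  qed
  have E_event: "E S \<in> events" for S
    unfolding E_def using assms(1) event by (intro sets.sets_Collect_finite_All) auto
  have probE: "prob (E S) = (\<Prod>i\<in>S. b i) * (\<Prod>i\<in>I - S. 1 - b i)" if "S \<subseteq> I" for S
  proof (cases "I = {}")
    case True
    then show ?thesis using that by (simp add: E_def prob_space)
  next
    case False
    have "E S = (\<Inter>i\<in>I. X i -` {v S i} \<inter> space M)"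
      using False by (auto simp: E_def)
    also have "prob \<dots> = (\<Prod>i\<in>I. prob (X i -` {v S i} \<inter> space M))"
      using False assms by (intro indep_varsD[OF assms(2)]) auto
    also have "\<dots> = (\<Prod>i\<in>I. prob {\<omega>\<in>space M. X i \<omega> = v S i})"
      by (intro prod.cong refl arg_cong[where f = prob]) auto
    also have "\<dots> = (\<Prod>i\<in>I. if i \<in> S then b i else 1 - b i)"
      using b prob0 by (intro prod.cong) (auto simp: v_def)
    also have "\<dots> = (\<Prod>i\<in>S. b i) * (\<Prod>i\<in>I - S. 1 - b i)"
      using that assms(1) by (subst prod.If_cases) (auto simp: Int_absorb1 Diff_eq)
    finally show ?thesis .
  qed
  have sum_v: "(\<Sum>i\<in>I. v S i) = card S" if "S \<subseteq> I" for S
    using that assms(1) by (simp add: v_def sum.If_cases Int_absorb1)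
  have "{\<omega>\<in>space M. (\<Sum>i\<in>I. X i \<omega>) = k} = (\<Union>S\<in>{S. S \<subseteq> I \<and> card S = k}. E S)"
  proof (intro set_eqI iffI)
    fix \<omega> assume \<omega>: "\<omega> \<in> {\<omega>\<in>space M. (\<Sum>i\<in>I. X i \<omega>) = k}"
    define S where "S = {i\<in>I. X i \<omega> = 1}"
    have X_v: "X i \<omega> = v S i" if "i \<in> I" for i
      using range[OF that, of \<omega>] \<omega> that by (auto simp: v_def S_def)
    then have "card S = k"
      using \<omega> sum_v[of S] by (simp add: S_def)
    then show "\<omega> \<in> (\<Union>S\<in>{S. S \<subseteq> I \<and> card S = k}. E S)"
      using X_v \<omega> by (intro UN_I[of S]) (auto simp: E_def S_def)
  next
    fix \<omega> assume "\<omega> \<in> (\<Union>S\<in>{S. S \<subseteq> I \<and> card S = k}. E S)"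
    then show "\<omega> \<in> {\<omega>\<in>space M. (\<Sum>i\<in>I. X i \<omega>) = k}"
      using sum_v by (auto simp: E_def)
  qed
  also have "prob \<dots> = (\<Sum>S | S \<subseteq> I \<and> card S = k. prob (E S))"
  proof (rule finite_measure_finite_Union)
    have "S = {i\<in>I. X i \<omega> = 1}" if "S \<subseteq> I" "\<omega> \<in> E S" for S \<omega>
      using that by (auto simp: E_def v_def split: if_splits)
    then show "disjoint_family_on E {S. S \<subseteq> I \<and> card S = k}"
      unfolding disjoint_family_on_def by blast
  qed (use assms(1) E_event in auto)
  also have "\<dots> = poisson_binomial I b k"
    unfolding poisson_binomial_def by (intro sum.cong) (auto simp: probE)
  finally show ?thesis .
qed

section \<open>Comparison with the Poisson weights\<close>

lemma poisson_ratio_upper: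
  fixes b :: "'i \<Rightarrow> real"
  assumes "finite I" and nn: "\<And>i. i \<in> I \<Longrightarrow> 0 \<le> b i" and le1: "\<And>i. i \<in> I \<Longrightarrow> b i \<le> 1"
    and le: "\<And>i. i \<in> I \<Longrightarrow> b i \<le> m" and pos: "0 < sum b I"
  shows "poisson_binomial I b k / (exp (- sum b I) * sum b I ^ k / fact k) \<le> exp (real k * m)"
proof -
  have failures: "(\<Prod>i\<in>I - S. 1 - b i) \<le> exp (real k * m - sum b I)"
    if S: "S \<subseteq> I" "card S = k" for S
  proof -
    have "(\<Prod>i\<in>I - S. 1 - b i) \<le> (\<Prod>i\<in>I - S. exp (- b i))"
      using le1 exp_ge_add_one_self[of "- b i" for i] by (intro prod_mono) auto
    also have "\<dots> = exp (sum b S - sum b I)"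
      using S assms(1) by (simp flip: exp_sum add: sum_negf sum_diff)
    also have "\<dots> \<le> exp (real k * m - sum b I)"
      using sum_bounded_above[of S b m] le S by auto
    finally show ?thesis .
  qed
  have "poisson_binomial I b k
      \<le> (\<Sum>S | S \<subseteq> I \<and> card S = k. (\<Prod>i\<in>S. b i) * exp (real k * m - sum b I))"
    unfolding poisson_binomial_def using nn failures
    by (intro sum_mono mult_left_mono prod_nonneg) auto
  also have "\<dots> = exp (real k * m) * exp (- sum b I) * elem_sym I b k"
    by (simp add: elem_sym_def sum_distrib_left mult.commute flip: exp_add)
  also have "\<dots> \<le> exp (real k * m) * exp (- sum b I) * (sum b I ^ k / fact k)"
    using fact_elem_sym_le[of I b k] assms(1) nn
    by (intro mult_left_mono) (auto simp: field_simps)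
  finally show ?thesis
    using pos by (subst pos_divide_le_eq) (simp_all add: mult.assoc)
qed

lemma poisson_ratio_lower:
  fixes b :: "'i \<Rightarrow> real"
  assumes "finite I" and nn: "\<And>i. i \<in> I \<Longrightarrow> 0 \<le> b i" and le2: "\<And>i. i \<in> I \<Longrightarrow> b i \<le> 1/2"
    and le: "\<And>i. i \<in> I \<Longrightarrow> b i \<le> m" and pos: "0 < sum b I" and km: "real k * m \<le> sum b I"
  shows "exp (- 2 * (\<Sum>i\<in>I. (b i)\<^sup>2)) * (1 - (real k)\<^sup>2 * m / sum b I)
       \<le> poisson_binomial I b k / (exp (- sum b I) * sum b I ^ k / fact k)"
proof -
  let ?l = "sum b I" and ?s = "\<Sum>i\<in>I. (b i)\<^sup>2"
  have m: "0 \<le> m"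
  proof -
    obtain i where "i \<in> I" using pos by fastforce
    then show ?thesis using nn le by force
  qed
  have failures: "exp (- ?l - 2 * ?s) \<le> (\<Prod>i\<in>I - S. 1 - b i)" if "S \<subseteq> I" for S
  proof -
    have "exp (- ?l - 2 * ?s) = (\<Prod>i\<in>I. exp (- b i - 2 * (b i)\<^sup>2))"
      using assms(1) by (simp flip: exp_sum add: sum_subtractf sum_negf sum_distrib_left)
    also have "\<dots> \<le> (\<Prod>i\<in>I. 1 - b i)"
    proof (intro prod_mono conjI)
      fix i assume i: "i \<in> I"
      have "- b i - 2 * (b i)\<^sup>2 \<le> ln (1 - b i)"
        using i nn le2 by (intro ln_one_minus_pos_lower_bound) auto
      then show "exp (- b i - 2 * (b i)\<^sup>2) \<le> 1 - b i"
        using le2[OF i] by (subst (asm) ln_ge_iff) auto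
    qed simp
    also have "\<dots> = (\<Prod>i\<in>I - S. 1 - b i) * (\<Prod>i\<in>S. 1 - b i)"
      using that assms(1) by (rule prod.subset_diff)
    also have "\<dots> \<le> (\<Prod>i\<in>I - S. 1 - b i) * 1"
      using that nn le2 by (intro mult_left_mono prod_le_1 prod_nonneg) force+
    finally show ?thesis by simp
  qed
  have bernoulli: "1 - (real k)\<^sup>2 * m / ?l \<le> (1 - real k * m / ?l) ^ k"
    using Bernoulli_inequality[of "- (real k * m / ?l)" k] km pos
    by (simp add: power2_eq_square field_simps)
  have "?l ^ k * (1 - (real k)\<^sup>2 * m / ?l) \<le> (?l * (1 - real k * m / ?l)) ^ k"
    using bernoulli pos by (simp add: power_mult_distrib)
  also have "\<dots> = (?l - real k * m) ^ k"
    using pos by (simp add: right_diff_distrib)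
  also have "\<dots> \<le> fact k * elem_sym I b k"
    using assms m by (intro fact_elem_sym_ge) auto
  finally have "exp (- ?l - 2 * ?s) * (?l ^ k * (1 - (real k)\<^sup>2 * m / ?l) / fact k)
      \<le> exp (- ?l - 2 * ?s) * elem_sym I b k"
    by (intro mult_left_mono) (auto simp: field_simps)
  also have "\<dots> = (\<Sum>S | S \<subseteq> I \<and> card S = k. (\<Prod>i\<in>S. b i) * exp (- ?l - 2 * ?s))"
    unfolding elem_sym_def sum_distrib_left[of "exp _"] by (simp only: mult.commute)
  also have "\<dots> \<le> poisson_binomial I b k"
    unfolding poisson_binomial_def using nn failures
    by (intro sum_mono mult_left_mono prod_nonneg) auto
  finally have "exp (- ?l - 2 * ?s) * (?l ^ k * (1 - (real k)\<^sup>2 * m / ?l) / fact k)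
      \<le> poisson_binomial I b k" .
  moreover have "exp (- ?l - 2 * ?s) = exp (- 2 * ?s) * exp (- ?l)"
    by (simp flip: exp_add)
  ultimately show ?thesis
    using pos by (subst pos_le_divide_eq) (simp_all add: mult_ac)
qed

text \<open>The deviation is controlled by one quantity \<open>t \<ge> k\<^sup>2 m\<close>, which is what makes the
  estimate uniform in \<open>k\<close>.\<close>

lemma poisson_ratio_deviation:
  fixes b :: "'i \<Rightarrow> real"
  assumes "finite I" and nn: "\<And>i. i \<in> I \<Longrightarrow> 0 \<le> b i" and le2: "\<And>i. i \<in> I \<Longrightarrow> b i \<le> 1/2"
    and le: "\<And>i. i \<in> I \<Longrightarrow> b i \<le> m" and "1 \<le> sum b I" and t: "(real k)\<^sup>2 * m \<le> t" "t \<le> 1"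
  shows "\<bar>poisson_binomial I b k / (exp (- sum b I) * sum b I ^ k / fact k) - 1\<bar>
       \<le> exp t - exp (- 2 * (\<Sum>i\<in>I. (b i)\<^sup>2)) * (1 - t)"
proof -
  let ?r = "poisson_binomial I b k / (exp (- sum b I) * sum b I ^ k / fact k)"
    and ?e = "exp (- 2 * (\<Sum>i\<in>I. (b i)\<^sup>2))"
  have m: "0 \<le> m"
  proof -
    obtain i where "i \<in> I" using \<open>1 \<le> sum b I\<close> by fastforce
    then show ?thesis using nn le by force
  qed
  have "real k \<le> (real k)\<^sup>2"
    by (cases "k = 0") (auto simp: power2_eq_square)
  then have "real k * m \<le> (real k)\<^sup>2 * m"
    using m by (rule mult_right_mono)
  then have kt: "real k * m \<le> t"
    using t by simp
  have t0: "0 \<le> t"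
    by (rule order_trans[OF mult_nonneg_nonneg[OF of_nat_0_le_iff m] kt])
  have le1: "b i \<le> 1" if "i \<in> I" for i
    using le2[OF that] by simp
  have "?r \<le> exp (real k * m)"
    by (rule poisson_ratio_upper[OF assms(1) nn le1 le]) (use \<open>1 \<le> sum b I\<close> in auto)
  also have "\<dots> \<le> exp t"
    using kt by simp
  finally have upper: "?r \<le> exp t" .
  have "(real k)\<^sup>2 * m / sum b I \<le> (real k)\<^sup>2 * m"
    using divide_left_mono[of 1 "sum b I" "(real k)\<^sup>2 * m"] m \<open>1 \<le> sum b I\<close> by simp
  then have "?e * (1 - t) \<le> ?e * (1 - (real k)\<^sup>2 * m / sum b I)"
    using t by (intro mult_left_mono) auto
  also have "\<dots> \<le> ?r"
    by (rule poisson_ratio_lower[OF assms(1) nn le2 le]) (use \<open>1 \<le> sum b I\<close> kt t in auto)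
  finally have lower: "?e * (1 - t) \<le> ?r" .
  have "?e \<le> 1"
    by (simp add: sum_nonneg)
  then have "?e * (1 - t) \<le> 1 * 1"
    using t t0 by (intro mult_mono) auto
  moreover have "1 \<le> exp t" using t0 by simp
  ultimately show ?thesis using upper lower by linarith
qed

section \<open>Triangular arrays\<close>

lemma row_max_ge: "i \<in> {1..n} \<Longrightarrow> b i n \<le> row_max b n"
  unfolding row_max_def by (intro Max_ge) auto

lemma row_max_attained:
  assumes "1 \<le> n"
  obtains i where "i \<in> {1..n}" "row_max b n = b i n"
proof -
  have "row_max b n \<in> (\<lambda>i. b i n) ` {1..n}"
    unfolding row_max_def using assms by (intro Max_in) auto
  then show ?thesis using that by auto
qed

lemma bernoulli_array_nonneg:
  assumes "bernoulli_array M X b" and "i \<in> {1..n}"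
  shows "0 \<le> b i n"
proof -
  have "1 \<le> n" using assms(2) by simp
  then have "measure (M n) {\<omega>\<in>space (M n). X i n \<omega> = 1} = b i n"
    using assms unfolding bernoulli_array_def by blast
  then show ?thesis by (metis measure_nonneg)
qed

lemma bernoulli_array_law:
  assumes "bernoulli_array M X b" and "1 \<le> n"
  shows "measure (M n) {\<omega>\<in>space (M n). (\<Sum>i=1..n. X i n \<omega>) = k}
       = poisson_binomial {1..n} (\<lambda>i. b i n) k"
proof -
  have A: "prob_space (M n)"
      "prob_space.indep_vars (M n) (\<lambda>_. count_space UNIV) (\<lambda>i. X i n) {1..n}"
      "\<And>i \<omega>. i \<in> {1..n} \<Longrightarrow> \<omega> \<in> space (M n) \<Longrightarrow> X i n \<omega> \<in> {0, 1}"
      "\<And>i. i \<in> {1..n} \<Longrightarrow> measure (M n) {\<omega>\<in>space (M n). X i n \<omega> = 1} = b i n"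
    using assms unfolding bernoulli_array_def by blast+
  show ?thesis
    by (rule prob_space.prob_sum_bernoulli[OF A(1) _ A(2)]) (use A in auto)
qed

text \<open>The square of the largest entry is one of the summands of the sum of squares.\<close>

lemma row_max_tendsto_0:
  assumes "bernoulli_array M X b" and "(\<lambda>n. \<Sum>i=1..n. (b i n)\<^sup>2) \<longlonglongrightarrow> 0"
  shows "row_max b \<longlonglongrightarrow> 0"
proof (rule tendsto_sandwich)
  have *: "0 \<le> row_max b n \<and> row_max b n \<le> sqrt (\<Sum>i=1..n. (b i n)\<^sup>2)" if "1 \<le> n" for n
  proof -
    obtain i where i: "i \<in> {1..n}" "row_max b n = b i n"
      using \<open>1 \<le> n\<close> by (rule row_max_attained)
    have "(b i n)\<^sup>2 \<le> (\<Sum>i=1..n. (b i n)\<^sup>2)"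
      using i by (intro member_le_sum) auto
    then show ?thesis
      using i bernoulli_array_nonneg[OF assms(1) i(1)] by (auto intro: real_le_rsqrt)
  qed
  show "\<forall>\<^sub>F n in sequentially. 0 \<le> row_max b n"
    and "\<forall>\<^sub>F n in sequentially. row_max b n \<le> sqrt (\<Sum>i=1..n. (b i n)\<^sup>2)"
    using * by (auto intro: eventually_sequentiallyI[of 1])
  show "(\<lambda>n. sqrt (\<Sum>i=1..n. (b i n)\<^sup>2)) \<longlonglongrightarrow> 0"
    using tendsto_real_sqrt[OF assms(2)] by simp
qed simp

lemma sup_or_zero_bounds:
  assumes "0 \<le> B" and "\<And>k. k \<in> S \<Longrightarrow> 0 \<le> f k" and "\<And>k. k \<in> S \<Longrightarrow> f k \<le> B"
  shows "0 \<le> sup_or_zero S f" and "sup_or_zero S f \<le> B"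
proof -
  have "bdd_above (f ` S)"
    using assms(3) by (rule bdd_aboveI2)
  then have "0 \<le> (SUP k\<in>S. f k)" if "k \<in> S" for k
    using that assms(2)[OF that] by (rule cSUP_upper2)
  then show "0 \<le> sup_or_zero S f"
    by (auto simp: sup_or_zero_def)
  show "sup_or_zero S f \<le> B"
    unfolding sup_or_zero_def using assms(1,3) by (simp add: cSUP_least)
qed

theorem theorem3:
  fixes M :: "nat \<Rightarrow> 'a measure"
    and X :: "nat \<Rightarrow> nat \<Rightarrow> 'a \<Rightarrow> nat"
    and b :: "nat \<Rightarrow> nat \<Rightarrow> real"
  assumes "bernoulli_array M X b"
    and "filterlim (row_sum b) at_top sequentially"
    and "(\<lambda>n. \<Sum>i=1..n. (b i n)\<^sup>2) \<longlonglongrightarrow> 0"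
  shows "row_max b \<longlonglongrightarrow> 0 \<and>
    (\<forall>\<phi> :: nat \<Rightarrow> real. (\<lambda>n. \<phi> n * row_max b n) \<longlonglongrightarrow> 0 \<longrightarrow>
      (\<lambda>n. sup_or_zero {k :: nat. (real k)\<^sup>2 \<le> \<phi> n}
        (\<lambda>k. \<bar>measure (M n) {\<omega>\<in>space (M n). (\<Sum>i=1..n. X i n \<omega>) = k}
              / (exp (- row_sum b n) * row_sum b n ^ k / fact k) - 1\<bar>)) \<longlonglongrightarrow> 0)"
proof (intro conjI allI impI)
  show max0: "row_max b \<longlonglongrightarrow> 0"
    using assms(1,3) by (rule row_max_tendsto_0)
  fix \<phi> :: "nat \<Rightarrow> real"
  assume \<phi>: "(\<lambda>n. \<phi> n * row_max b n) \<longlonglongrightarrow> 0"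
  define s where "s n = (\<Sum>i=1..n. (b i n)\<^sup>2)" for n
  \<comment> \<open>The absolute value keeps the bound below nonnegative when \<open>\<phi> n < 0\<close>, where the supremum
    is over the empty set.\<close>
  define t where "t n = \<bar>\<phi> n * row_max b n\<bar>" for n
  define B where "B n = exp (t n) - exp (- 2 * s n) * (1 - t n)" for n
  define f where "f n k = \<bar>measure (M n) {\<omega>\<in>space (M n). (\<Sum>i=1..n. X i n \<omega>) = k}
              / (exp (- row_sum b n) * row_sum b n ^ k / fact k) - 1\<bar>" for n k
  have t0: "t \<longlonglongrightarrow> 0"
    unfolding t_def using \<phi> by (rule tendsto_rabs_zero)
  have s0: "s \<longlonglongrightarrow> 0"
    unfolding s_def by (rule assms(3))
  have "B \<longlonglongrightarrow> exp 0 - exp (- 2 * 0) * (1 - 0)"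
    unfolding B_def by (intro tendsto_intros t0 s0)
  then have B0: "B \<longlonglongrightarrow> 0" by simp
  have "\<forall>\<^sub>F n in sequentially. 1 \<le> n \<and> row_max b n < 1/2 \<and> t n < 1 \<and> 1 \<le> row_sum b n"
    using order_tendstoD(2)[OF max0, of "1/2"] order_tendstoD(2)[OF t0, of 1]
      filterlim_at_top[THEN iffD1, OF assms(2), rule_format, of 1] eventually_ge_at_top[of 1]
    by (auto simp: eventually_conj_iff)
  then have "\<forall>\<^sub>F n in sequentially. 0 \<le> sup_or_zero {k. (real k)\<^sup>2 \<le> \<phi> n} (f n)
      \<and> sup_or_zero {k. (real k)\<^sup>2 \<le> \<phi> n} (f n) \<le> B n"
  proof (rule eventually_mono)
    fix n assume n: "1 \<le> n \<and> row_max b n < 1/2 \<and> t n < 1 \<and> 1 \<le> row_sum b n"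
    have nn: "0 \<le> b i n" if "i \<in> {1..n}" for i
      using assms(1) that by (rule bernoulli_array_nonneg)
    have "0 \<le> row_max b n"
      using row_max_ge[of 1 n b] nn[of 1] n by auto
    have "exp (- 2 * s n) * (1 - t n) \<le> 1 * 1"
      using n by (intro mult_mono) (auto simp: s_def t_def sum_nonneg)
    moreover have "1 \<le> exp (t n)" by (simp add: t_def)
    ultimately have "0 \<le> B n" unfolding B_def by linarith
    moreover have "f n k \<le> B n" if "(real k)\<^sup>2 \<le> \<phi> n" for k
    proof -
      have "(real k)\<^sup>2 * row_max b n \<le> \<phi> n * row_max b n"
        using that \<open>0 \<le> row_max b n\<close> by (rule mult_right_mono)
      then have "(real k)\<^sup>2 * row_max b n \<le> t n" by (simp add: t_def)
      moreover have "b i n \<le> 1/2" if "i \<in> {1..n}" for i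
        using row_max_ge[OF that, of b] n by linarith
      ultimately show ?thesis
        unfolding f_def B_def s_def bernoulli_array_law[OF assms(1) conjunct1[OF n]] row_sum_def
        using n nn row_max_ge
        by (intro poisson_ratio_deviation[where m = "row_max b n"]) (auto simp: row_sum_def)
    qed
    ultimately show "0 \<le> sup_or_zero {k. (real k)\<^sup>2 \<le> \<phi> n} (f n)
      \<and> sup_or_zero {k. (real k)\<^sup>2 \<le> \<phi> n} (f n) \<le> B n"
      using sup_or_zero_bounds[of "B n" "{k. (real k)\<^sup>2 \<le> \<phi> n}" "f n"] by (auto simp: f_def)
  qed
  then show "(\<lambda>n. sup_or_zero {k. (real k)\<^sup>2 \<le> \<phi> n} (\<lambda>k.
      \<bar>measure (M n) {\<omega>\<in>space (M n). (\<Sum>i=1..n. X i n \<omega>) = k}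
              / (exp (- row_sum b n) * row_sum b n ^ k / fact k) - 1\<bar>)) \<longlonglongrightarrow> 0"
    unfolding f_def[symmetric] eventually_conj_iff
    by (intro tendsto_sandwich[OF _ _ tendsto_const B0]) auto
qed

end
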